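(* Let $\mu$ be a weight on $\mathbb{D}$ and let $\phi:\mathbb{D}\to\mathbb{D}$ be holomorphic. Suppose that $C_\phi:\mathcal{B}^{\log}\to\mathcal{B}^{\mu}$, i.e. that $f\circ\phi\in\mathcal{B}^{\mu}$ for every $f\in\mathcal{B}^{\log}$. Then the following three statements are equivalent: (i) $C_\phi:\mathcal{B}^{\log}\to\mathcal{B}^{\mu}$ is compact; (ii) $\displaystyle\lim_{j\to\infty}\frac{\|\phi^j\|_{\mu}}{\log(j+1)}=0$; (iii) $\displaystyle\lim_{j\to\infty}\frac{\|\phi^j\|_{\mu}}{\|F_j\|_{\log}}=0$.
   Context: $\mathbb{D}$ is the open unit disk in $\mathbb{C}$, $\mathcal{H}(\mathbb{D})$ the space of holomorphic functions on $\mathbb{D}$, and $\log$ is the natural logarithm. A weight on $\mathbb{D}$ is a bounded, continuous, strictly positive function $\mu:\mathbb{D}\to(0,\infty)$. For a weight $\mu$ and $f\in\mathcal{H}(\mathbb{D})$, put $\|f\|_\mu:=\sup_{z\in\mathbb{D}}\mu(z)|f'(z)|$; the $\mu$-Bloch space $\mathcal{B}^\mu$ is the set of $f\in\mathcal{H}(\mathbb{D})$ with $\|f\|_\mu<\infty$, a Banach space under the norm $\|f\|_{\mathcal{B}^\mu}:=|f(0)|+\|f\|_\mu$. The log-Bloch space $\mathcal{B}^{\log}$ is $\mathcal{B}^{\mu}$ for the weight $\mu=v_{\log}$, $v_{\log}(z)=(1-|z|)\log\left(\frac{3}{1-|z|}\right)$; its seminorm $\|\cdot\|_{v_{\log}}$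 is written $\|\cdot\|_{\log}$. $C_\phi f:=f\circ\phi$ is the composition operator with symbol $\phi$. $F_j(z):=z^j$ on $\mathbb{D}$, and $\phi^j$ is the pointwise $j$th power of $\phi$. *)

theory Defs
  imports "HOL-Complex_Analysis.Complex_Analysis"
begin

abbreviation unit_disk :: "complex set" where
  "unit_disk \<equiv> ball 0 1"

definition disk_weight :: "(complex \<Rightarrow> real) \<Rightarrow> bool" where
  "disk_weight \<mu> \<longleftrightarrow>
     bounded (\<mu> ` unit_disk) \<and> continuous_on unit_disk \<mu> \<and> (\<forall>z\<in>unit_disk. 0 < \<mu> z)"

text \<open>The supremum is taken in the reals, so \<open>bloch_seminorm \<mu> f\<close> is meaningful only if
  \<open>bloch_finite \<mu> f\<close>, which says that the extended real supremum is finite.\<close>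

definition bloch_seminorm :: "(complex \<Rightarrow> real) \<Rightarrow> (complex \<Rightarrow> complex) \<Rightarrow> real" where
  "bloch_seminorm \<mu> f = (SUP z\<in>unit_disk. \<mu> z * cmod (deriv f z))"

definition bloch_finite :: "(complex \<Rightarrow> real) \<Rightarrow> (complex \<Rightarrow> complex) \<Rightarrow> bool" where
  "bloch_finite \<mu> f \<longleftrightarrow> bdd_above ((\<lambda>z. \<mu> z * cmod (deriv f z)) ` unit_disk)"

text \<open>A function on the disk is represented by its extensional extension to the whole plane
  (value \<open>undefined\<close> off the disk), so that functions agreeing on the disk are equal.\<close>

definition bloch_space :: "(complex \<Rightarrow> real) \<Rightarrow> (complex \<Rightarrow> complex) set" where
  "bloch_space \<mu> = {f \<in> extensional unit_disk. f holomorphic_on unit_disk \<and> bloch_finite \<mu> f}"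

definition bloch_norm :: "(complex \<Rightarrow> real) \<Rightarrow> (complex \<Rightarrow> complex) \<Rightarrow> real" where
  "bloch_norm \<mu> f = cmod (f 0) + bloch_seminorm \<mu> f"

definition bloch_dist ::
    "(complex \<Rightarrow> real) \<Rightarrow> (complex \<Rightarrow> complex) \<Rightarrow> (complex \<Rightarrow> complex) \<Rightarrow> real" where
  "bloch_dist \<mu> f g =
     (if f \<in> bloch_space \<mu> \<and> g \<in> bloch_space \<mu> then bloch_norm \<mu> (\<lambda>z. f z - g z) else 0)"

text \<open>The value 0 outside the carrier only serves to meet the totality conditions of
  \<^locale>\<open>Metric_space\<close>.\<close>

definition bloch_topology :: "(complex \<Rightarrow> real) \<Rightarrow> (complex \<Rightarrow> complex) topology" where
  "bloch_topology \<mu> = Metric_space.mtopology (bloch_space \<mu>) (bloch_dist \<mu>)"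

definition v_log :: "complex \<Rightarrow> real" where
  "v_log z = (1 - cmod z) * ln (3 / (1 - cmod z))"

definition comp_op :: "(complex \<Rightarrow> complex) \<Rightarrow> (complex \<Rightarrow> complex) \<Rightarrow> (complex \<Rightarrow> complex)" where
  "comp_op \<phi> f = restrict (f \<circ> \<phi>) unit_disk"

text \<open>Compactness of a linear operator \<open>T\<close> between two Bloch spaces: the image of the closed
  unit ball is relatively compact. Linearity is not part of the definition; it is evident for
  composition operators.\<close>

definition bloch_compact_operator ::
    "(complex \<Rightarrow> real) \<Rightarrow> (complex \<Rightarrow> real) \<Rightarrow>
     ((complex \<Rightarrow> complex) \<Rightarrow> (complex \<Rightarrow> complex)) \<Rightarrow> bool" where
  "bloch_compact_operator \<nu> \<mu> T \<longleftrightarrow>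
     T ` bloch_space \<nu> \<subseteq> bloch_space \<mu> \<and>
     compactin (bloch_topology \<mu>)
       (bloch_topology \<mu> closure_of (T ` {f \<in> bloch_space \<nu>. bloch_norm \<nu> f \<le> 1}))"

lemma bloch_deriv_diff:
  assumes "f \<in> bloch_space \<mu>" "g \<in> bloch_space \<mu>" "z \<in> unit_disk"
  shows "deriv (\<lambda>z. f z - g z) z = deriv f z - deriv g z"
proof -
  have "f field_differentiable at z" "g field_differentiable at z"
    using assms holomorphic_on_imp_differentiable_at[OF _ open_ball]
    by (auto simp: bloch_space_def)
  then show ?thesis by (rule deriv_diff)
qed

lemma bloch_finite_diff:
  assumes w: "disk_weight \<mu>" and f: "f \<in> bloch_space \<mu>" and g: "g \<in> bloch_space \<mu>"
  shows "bloch_finite \<mu> (\<lambda>z. f z - g z)"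
proof -
  obtain A B where A: "\<And>z. z \<in> unit_disk \<Longrightarrow> \<mu> z * cmod (deriv f z) \<le> A"
    and B: "\<And>z. z \<in> unit_disk \<Longrightarrow> \<mu> z * cmod (deriv g z) \<le> B"
    using f g unfolding bloch_space_def bloch_finite_def bdd_above_def ball_simps by blast
  have "\<mu> z * cmod (deriv (\<lambda>z. f z - g z) z) \<le> A + B" if z: "z \<in> unit_disk" for z
  proof -
    have "0 < \<mu> z" using w z by (auto simp: disk_weight_def)
    then have "\<mu> z * cmod (deriv f z - deriv g z) \<le> \<mu> z * (cmod (deriv f z) + cmod (deriv g z))"
      by (intro mult_left_mono norm_triangle_ineq4) auto
    also have "\<dots> \<le> A + B" using A[OF z] B[OF z] by (simp add: distrib_left)
    finally show ?thesis using bloch_deriv_diff[OF f g z] by simp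
  qed
  then show ?thesis unfolding bloch_finite_def by (intro bdd_aboveI2)
qed

lemma bloch_seminorm_ge:
  assumes "bloch_finite \<mu> f" "z \<in> unit_disk"
  shows "\<mu> z * cmod (deriv f z) \<le> bloch_seminorm \<mu> f"
  using assms unfolding bloch_finite_def bloch_seminorm_def by (rule cSUP_upper[rotated])

lemma bloch_seminorm_nonneg:
  assumes "disk_weight \<mu>" "bloch_finite \<mu> f"
  shows "0 \<le> bloch_seminorm \<mu> f"
proof -
  have "0 \<le> \<mu> 0 * cmod (deriv f 0)" using assms by (auto simp: disk_weight_def less_imp_le)
  also have "\<dots> \<le> bloch_seminorm \<mu> f" using assms(2) by (rule bloch_seminorm_ge) auto
  finally show ?thesis .
qed

lemma Metric_space_bloch:
  assumes w: "disk_weight \<mu>"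
  shows "Metric_space (bloch_space \<mu>) (bloch_dist \<mu>)"
proof
  show "0 \<le> bloch_dist \<mu> f g" for f g
    using bloch_finite_diff[OF w] bloch_seminorm_nonneg[OF w]
    by (auto simp: bloch_dist_def bloch_norm_def)
next
  show "bloch_dist \<mu> f g = bloch_dist \<mu> g f" for f g
  proof (cases "f \<in> bloch_space \<mu> \<and> g \<in> bloch_space \<mu>")
    case True
    then have "cmod (deriv (\<lambda>z. f z - g z) z) = cmod (deriv (\<lambda>z. g z - f z) z)"
      if "z \<in> unit_disk" for z
      using that True bloch_deriv_diff[of f \<mu> g z] bloch_deriv_diff[of g \<mu> f z]
      by (metis norm_minus_commute)
    then have "bloch_seminorm \<mu> (\<lambda>z. f z - g z) = bloch_seminorm \<mu> (\<lambda>z. g z - f z)"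
      unfolding bloch_seminorm_def by (intro SUP_cong refl) simp
    with True show ?thesis by (simp add: bloch_dist_def bloch_norm_def norm_minus_commute)
  qed (auto simp: bloch_dist_def)
next
  fix f g assume f: "f \<in> bloch_space \<mu>" and g: "g \<in> bloch_space \<mu>"
  show "bloch_dist \<mu> f g = 0 \<longleftrightarrow> f = g"
  proof
    assume "f = g"
    then show "bloch_dist \<mu> f g = 0" by (simp add: bloch_dist_def bloch_norm_def bloch_seminorm_def)
  next
    assume d: "bloch_dist \<mu> f g = 0"
    let ?h = "\<lambda>z. f z - g z"
    have fin: "bloch_finite \<mu> ?h" by (rule bloch_finite_diff[OF w f g])
    have 0: "?h 0 = 0" "bloch_seminorm \<mu> ?h = 0"
      using d bloch_seminorm_nonneg[OF w fin]
      by (simp_all add: f g bloch_dist_def bloch_norm_def add_nonneg_eq_0_iff)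
    have hol: "?h holomorphic_on unit_disk"
      using f g by (auto simp: bloch_space_def intro!: holomorphic_intros)
    have "deriv ?h z = 0" if z: "z \<in> unit_disk" for z
    proof -
      have "0 < \<mu> z" using w z by (auto simp: disk_weight_def)
      then show ?thesis
        using bloch_seminorm_ge[OF fin z] 0(2) by (simp add: mult_le_0_iff)
    qed
    then have "(?h has_field_derivative 0) (at z within unit_disk)" if "z \<in> unit_disk" for z
      using that holomorphic_derivI[OF hol open_ball that] by auto
    then obtain c where c: "\<And>z. z \<in> unit_disk \<Longrightarrow> ?h z = c"
      using has_field_derivative_zero_constant[of unit_disk ?h] by auto
    with 0(1) have "f z = g z" if "z \<in> unit_disk" for z
      using c[OF that] c[of 0] by simp
    then show "f = g"
      using f g by (intro extensionalityI[of _ unit_disk]) (auto simp: bloch_space_def)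
  qed
next
  fix f g h assume f: "f \<in> bloch_space \<mu>" and g: "g \<in> bloch_space \<mu>" and h: "h \<in> bloch_space \<mu>"
  have "bloch_seminorm \<mu> (\<lambda>z. f z - h z)
      \<le> bloch_seminorm \<mu> (\<lambda>z. f z - g z) + bloch_seminorm \<mu> (\<lambda>z. g z - h z)"
    unfolding bloch_seminorm_def[of \<mu> "\<lambda>z. f z - h z"]
  proof (rule cSUP_least)
    fix z assume z: "z \<in> unit_disk"
    have "0 < \<mu> z" using w z by (auto simp: disk_weight_def)
    then have "\<mu> z * cmod (deriv f z - deriv h z)
        \<le> \<mu> z * (cmod (deriv f z - deriv g z) + cmod (deriv g z - deriv h z))"
      using norm_triangle_ineq[of "deriv f z - deriv g z" "deriv g z - deriv h z"]
      by (intro mult_left_mono) auto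
    also have "\<dots> \<le> bloch_seminorm \<mu> (\<lambda>z. f z - g z) + bloch_seminorm \<mu> (\<lambda>z. g z - h z)"
      using bloch_seminorm_ge[OF bloch_finite_diff[OF w f g] z]
        bloch_seminorm_ge[OF bloch_finite_diff[OF w g h] z]
      by (simp add: distrib_left bloch_deriv_diff[OF f g z] bloch_deriv_diff[OF g h z])
    finally show "\<mu> z * cmod (deriv (\<lambda>z. f z - h z) z)
        \<le> bloch_seminorm \<mu> (\<lambda>z. f z - g z) + bloch_seminorm \<mu> (\<lambda>z. g z - h z)"
      by (simp add: bloch_deriv_diff[OF f h z])
  qed auto
  moreover have "cmod (f 0 - h 0) \<le> cmod (f 0 - g 0) + cmod (g 0 - h 0)"
    using norm_triangle_ineq[of "f 0 - g 0" "g 0 - h 0"] by simp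
  ultimately show "bloch_dist \<mu> f h \<le> bloch_dist \<mu> f g + bloch_dist \<mu> g h"
    using f g h by (simp add: bloch_dist_def bloch_norm_def)
qed

end

theory Submission
  imports Defs
begin

text \<open>
  The seminorm of the monomial \<open>z\<^sup>j\<close> in the log-Bloch space is comparable to \<open>ln (j + 1)\<close>: the function
  \<open>j r\<^bsup>j-1\<^esup> (1 - r) ln (3 / (1 - r))\<close> is governed by its values at \<open>1 - r \<approx> 1 / j\<close>, where
  \<open>j r\<^bsup>j-1\<^esup> (1 - r)\<close> has constant size (\<open>monomial_in_log_bloch\<close>, \<open>log_le_bloch_seminorm_monomial\<close>).
  This makes the two limit conditions equivalent.

  If the operator is compact, apply it to the normalised monomials. Their derivatives tend to
  \<open>0\<close> pointwise, so every limit point of their images has derivative \<open>0\<close>; by compactness the images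
  tend to \<open>0\<close> in seminorm (\<open>compact_comp_op_null\<close>), which is the condition on the quotients of
  seminorms.

  Conversely, fix \<open>z\<close>, put \<open>t = 1 - \<bar>\<phi> z\<bar>\<close> and take the single exponent \<open>j = \<lfloor>1 / t\<rfloor>\<close>. For this \<open>j\<close> the
  derivative \<open>j \<phi>\<^bsup>j-1\<^esup> \<phi>'\<close> of \<open>\<phi>\<^sup>j\<close> at \<open>z\<close> has size comparable to \<open>\<bar>\<phi>' z\<bar> / t\<close>, while
  \<open>ln (j + 1) \<le> ln (3 / t)\<close>. So the limit condition says that \<open>\<mu> z \<bar>\<phi>' z\<bar>\<close> is small compared with
  \<open>t ln (3 / t)\<close>, the weight at \<open>\<phi> z\<close>, as soon as \<open>\<phi> z\<close> is near the unit circle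
  (\<open>power_seminorm_log_vanishing\<close>). Such boundary decay gives compactness for any pair of weights
  (\<open>comp_op_compact_if_vanishing\<close>): by Montel's theorem a sequence in the unit ball has a subsequence
  whose derivatives converge uniformly on compact sets (\<open>bloch_ball_normal\<close>), which controls the
  points with \<open>\<phi> z\<close> away from the circle, and the decay controls the others.
\<close>

section \<open>Functions in a Bloch space and composition\<close>

lemma deriv_cong_disk:
  assumes "\<And>z. z \<in> unit_disk \<Longrightarrow> f z = g z" "z \<in> unit_disk"
  shows "deriv f z = deriv g z"
proof (rule deriv_cong_ev)
  show "eventually (\<lambda>w. f w = g w) (nhds z)"
    using eventually_nhds_in_open[OF open_ball assms(2)] by eventually_elim (rule assms(1))
qed simp

lemma bloch_seminorm_le:
  assumes "\<And>z. z \<in> unit_disk \<Longrightarrow> \<mu> z * cmod (deriv f z) \<le> B"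
  shows "bloch_seminorm \<mu> f \<le> B"
  unfolding bloch_seminorm_def by (rule cSUP_least) (use assms in auto)

lemma restrict_in_bloch_space:
  assumes "h holomorphic_on unit_disk"
    and "\<And>z. z \<in> unit_disk \<Longrightarrow> \<mu> z * cmod (deriv h z) \<le> B"
  shows "restrict h unit_disk \<in> bloch_space \<mu>"
proof -
  have "deriv (restrict h unit_disk) z = deriv h z" if "z \<in> unit_disk" for z
    using that by (intro deriv_cong_disk) auto
  then have "bloch_finite \<mu> (restrict h unit_disk)"
    unfolding bloch_finite_def using assms(2) by (intro bdd_aboveI2[where M = B]) simp
  moreover have "restrict h unit_disk holomorphic_on unit_disk"
    using assms(1) by (rule holomorphic_transform) auto
  ultimately show ?thesis by (simp add: bloch_space_def)
qed

lemma bloch_space_holomorphic: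
  "f \<in> bloch_space \<mu> \<Longrightarrow> f holomorphic_on unit_disk"
  by (simp add: bloch_space_def)

lemma bloch_space_deriv_le:
  "f \<in> bloch_space \<mu> \<Longrightarrow> z \<in> unit_disk \<Longrightarrow> \<mu> z * cmod (deriv f z) \<le> bloch_seminorm \<mu> f"
  by (simp add: bloch_space_def bloch_seminorm_ge)

lemma deriv_compose_disk:
  assumes "\<phi> holomorphic_on unit_disk" "\<phi> ` unit_disk \<subseteq> unit_disk"
    and "f holomorphic_on unit_disk" "z \<in> unit_disk"
  shows "deriv (f \<circ> \<phi>) z = deriv f (\<phi> z) * deriv \<phi> z"
proof -
  have "\<phi> z \<in> unit_disk" using assms by blast
  then show ?thesis
    using assms holomorphic_on_imp_differentiable_at[OF _ open_ball] by (intro deriv_chain) auto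
qed

lemma deriv_comp_op:
  assumes "\<phi> holomorphic_on unit_disk" "\<phi> ` unit_disk \<subseteq> unit_disk"
    and "f holomorphic_on unit_disk" "z \<in> unit_disk"
  shows "deriv (comp_op \<phi> f) z = deriv f (\<phi> z) * deriv \<phi> z"
  unfolding deriv_compose_disk[OF assms, symmetric]
  using assms(4) by (intro deriv_cong_disk) (auto simp: comp_op_def)

lemma deriv_power_disk:
  "\<phi> holomorphic_on unit_disk \<Longrightarrow> z \<in> unit_disk \<Longrightarrow>
     deriv (\<lambda>z. \<phi> z ^ j) z = of_nat j * \<phi> z ^ (j - 1) * deriv \<phi> z"
  using holomorphic_derivI[OF _ open_ball, of \<phi>  0 1 z UNIV]
  by (intro DERIV_imp_deriv) (auto intro!: derivative_eq_intros)

lemma deriv_monomial: "deriv (\<lambda>z::complex. z ^ j) z = of_nat j * z ^ (j - 1)"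
  by (intro DERIV_imp_deriv) (auto intro!: derivative_eq_intros)

section \<open>Compactness of composition operators between Bloch spaces\<close>

lemma bloch_ball_deriv_bounded:
  assumes \<nu>: "disk_weight \<nu>" and K: "compact K" "K \<subseteq> unit_disk"
  obtains B where "\<And>f z. f \<in> bloch_space \<nu> \<Longrightarrow> bloch_norm \<nu> f \<le> 1 \<Longrightarrow> z \<in> K \<Longrightarrow> cmod (deriv f z) \<le> B"
proof -
  have "continuous_on K (\<lambda>z. 1 / \<nu> z)"
    using \<nu> K(2) by (intro continuous_intros) (force simp: disk_weight_def intro: continuous_on_subset)+
  then have "bounded ((\<lambda>z. 1 / \<nu> z) ` K)"
    using K(1) by (intro compact_imp_bounded compact_continuous_image)
  then obtain B where B: "\<And>z. z \<in> K \<Longrightarrow> \<bar>1 / \<nu> z\<bar> \<le> B"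
    by (auto simp: bounded_iff)
  have "cmod (deriv f z) \<le> B" if f: "f \<in> bloch_space \<nu>" "bloch_norm \<nu> f \<le> 1" and z: "z \<in> K" for f z
  proof -
    have zd: "z \<in> unit_disk" using z K(2) by blast
    then have pos: "0 < \<nu> z" using \<nu> by (auto simp: disk_weight_def)
    have "\<nu> z * cmod (deriv f z) \<le> 1"
      using bloch_space_deriv_le[OF f(1) zd] f(2) norm_ge_zero[of "f 0"]
      unfolding bloch_norm_def by linarith
    then have "cmod (deriv f z) \<le> 1 / \<nu> z" using pos by (simp add: field_simps)
    then show ?thesis using B[OF z] by linarith
  qed
  then show ?thesis using that by blast
qed

text \<open>The bound on \<open>f\<close> comes from integrating the bound on \<open>f'\<close> along segments from \<open>0\<close>. The convex
  hull of \<open>K\<close> and \<open>0\<close> is a compact subset of the disk that contains these segments.\<close>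

lemma bloch_ball_bounded:
  assumes \<nu>: "disk_weight \<nu>" and K: "compact K" "K \<subseteq> unit_disk"
  obtains B where "\<And>f z. f \<in> bloch_space \<nu> \<Longrightarrow> bloch_norm \<nu> f \<le> 1 \<Longrightarrow> z \<in> K \<Longrightarrow> cmod (f z) \<le> B"
proof -
  let ?H = "convex hull (insert 0 K)"
  have H: "compact ?H" using K(1) by (intro compact_convex_hull compact_insert)
  have H': "?H \<subseteq> unit_disk" using K(2) by (intro hull_minimal) auto
  obtain B where B: "\<And>f z. f \<in> bloch_space \<nu> \<Longrightarrow> bloch_norm \<nu> f \<le> 1 \<Longrightarrow> z \<in> ?H \<Longrightarrow> cmod (deriv f z) \<le> B"
    using bloch_ball_deriv_bounded[OF \<nu> H H'] by blast
  have "cmod (f z) \<le> 1 + B" if f: "f \<in> bloch_space \<nu>" "bloch_norm \<nu> f \<le> 1" and z: "z \<in> K" for f z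
  proof -
    have zH: "z \<in> ?H" "0 \<in> ?H" using z by (auto intro: hull_inc)
    have "(f has_field_derivative deriv f w) (at w within ?H)" if "w \<in> ?H" for w
      using that H' by (intro holomorphic_derivI[OF bloch_space_holomorphic[OF f(1)] open_ball]) auto
    then have "cmod (f z - f 0) \<le> B * cmod (z - 0)"
      using B[OF f] zH by (intro field_differentiable_bound[of ?H f "deriv f"]) auto
    also have "\<dots> \<le> B * 1"
    proof (rule mult_left_mono)
      show "0 \<le> B" using B[OF f zH(1)] norm_ge_zero[of "deriv f z"] by linarith
      show "cmod (z - 0) \<le> 1" using z K(2) by (auto simp: less_imp_le)
    qed
    finally have "cmod (f z - f 0) \<le> B" by simp
    moreover have "cmod (f 0) \<le> 1"
      using f bloch_seminorm_nonneg[OF \<nu>, of f] by (simp add: bloch_norm_def bloch_space_def)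
    ultimately show ?thesis using norm_triangle_sub[of "f z" "f 0"] by linarith
  qed
  then show ?thesis using that by blast
qed

text \<open>Montel's theorem is applied twice, to the functions and then to the derivatives along the
  subsequence found first. The second limit is the derivative of the first by Weierstrass' theorem
  on locally uniform limits, so both convergences hold along one subsequence. The unit ball is closed
  under this convergence because its defining inequality can be read off pointwise.\<close>

lemma bloch_ball_normal:
  fixes f :: "nat \<Rightarrow> complex \<Rightarrow> complex"
  assumes \<nu>: "disk_weight \<nu>" and f: "\<And>n. f n \<in> bloch_space \<nu>" "\<And>n. bloch_norm \<nu> (f n) \<le> 1"
  obtains g r where "g \<in> bloch_space \<nu>" "bloch_norm \<nu> g \<le> 1" "strict_mono r"
    "\<And>z. z \<in> unit_disk \<Longrightarrow> (\<lambda>n. f (r n) z) \<longlonglongrightarrow> g z"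
    "\<And>K. compact K \<Longrightarrow> K \<subseteq> unit_disk \<Longrightarrow> uniform_limit K (\<lambda>n. deriv (f (r n))) (deriv g) sequentially"
proof -
  let ?B = "{f \<in> bloch_space \<nu>. bloch_norm \<nu> f \<le> 1}"
  have bnd: "\<exists>B. \<forall>h\<in>?B. \<forall>z\<in>K. cmod (h z) \<le> B" if "compact K" "K \<subseteq> unit_disk" for K
    by (rule bloch_ball_bounded[OF \<nu> that]) blast
  have bnd': "\<exists>B. \<forall>h\<in>deriv ` ?B. \<forall>z\<in>K. cmod (h z) \<le> B" if "compact K" "K \<subseteq> unit_disk" for K
    by (rule bloch_ball_deriv_bounded[OF \<nu> that]) blast
  have hol: "h holomorphic_on unit_disk" if "h \<in> ?B" for h
    using that by (auto simp: bloch_space_holomorphic)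
  obtain g r where g: "g holomorphic_on unit_disk" and r: "strict_mono (r :: nat \<Rightarrow> nat)"
    and lim: "\<And>z. z \<in> unit_disk \<Longrightarrow> (\<lambda>n. f (r n) z) \<longlonglongrightarrow> g z"
    and unif: "\<And>K. compact K \<Longrightarrow> K \<subseteq> unit_disk \<Longrightarrow> uniform_limit K (f \<circ> r) g sequentially"
    using Montel[OF open_ball hol bnd, where \<F> = f] f by blast
  obtain g' s where s: "strict_mono (s :: nat \<Rightarrow> nat)"
    and lim': "\<And>z. z \<in> unit_disk \<Longrightarrow> (\<lambda>n. deriv (f (r (s n))) z) \<longlonglongrightarrow> g' z"
    and unif': "\<And>K. compact K \<Longrightarrow> K \<subseteq> unit_disk \<Longrightarrow>
                  uniform_limit K ((\<lambda>n. deriv (f (r n))) \<circ> s) g' sequentially"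
  proof (rule Montel[OF open_ball _ bnd', where \<F> = "\<lambda>n. deriv (f (r n))"])
    show "h holomorphic_on unit_disk" if "h \<in> deriv ` ?B" for h
      using that hol by (auto intro: holomorphic_deriv)
    show "range (\<lambda>n. deriv (f (r n))) \<subseteq> deriv ` ?B" using f by auto
  qed auto
  have eq: "g' z = deriv g z" if z: "z \<in> unit_disk" for z
  proof -
    obtain e where e: "0 < e" "cball z e \<subseteq> unit_disk"
      using z open_contains_cball[of unit_disk] by blast
    have "uniform_limit (ball z e) (f \<circ> r) g sequentially"
      using unif[OF compact_cball e(2)] by (rule uniform_limit_on_subset) auto
    then have "(\<lambda>n. deriv (f (r n)) z) \<longlonglongrightarrow> deriv g z"
      unfolding o_def using e f by (intro deriv_complex_uniform_limit[where A = "ball z e"] always_eventually)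
        (auto intro!: holomorphic_on_subset[OF bloch_space_holomorphic[OF f(1)]])
    then have "(\<lambda>n. deriv (f (r (s n))) z) \<longlonglongrightarrow> deriv g z"
      using LIMSEQ_subseq_LIMSEQ[OF _ s, of "\<lambda>n. deriv (f (r n)) z"] by (simp add: o_def)
    then show ?thesis using lim'[OF z] by (rule LIMSEQ_unique[rotated])
  qed
  let ?g = "restrict g unit_disk"
  have d: "deriv ?g z = g' z" if "z \<in> unit_disk" for z
    unfolding eq[OF that] using that by (intro deriv_cong_disk) auto
  have le: "cmod (g 0) + \<nu> z * cmod (g' z) \<le> 1" if z: "z \<in> unit_disk" for z
  proof (rule LIMSEQ_le_const2)
    show "(\<lambda>n. cmod (f (r (s n)) 0) + \<nu> z * cmod (deriv (f (r (s n))) z))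
        \<longlonglongrightarrow> cmod (g 0) + \<nu> z * cmod (g' z)"
      using lim'[OF z] LIMSEQ_subseq_LIMSEQ[OF lim[of 0] s]
      by (intro tendsto_intros) (auto simp: o_def)
    have "cmod (f n 0) + \<nu> z * cmod (deriv (f n) z) \<le> 1" for n
      using f(2)[of n] bloch_space_deriv_le[OF f(1) z, of n] unfolding bloch_norm_def by linarith
    then show "\<exists>N. \<forall>n\<ge>N. cmod (f (r (s n)) 0) + \<nu> z * cmod (deriv (f (r (s n))) z) \<le> 1"
      by blast
  qed
  show ?thesis
  proof (rule that[of ?g "r \<circ> s"])
    show "?g \<in> bloch_space \<nu>"
      using g le eq by (intro restrict_in_bloch_space[where B = "1 - cmod (g 0)"]) (auto simp: algebra_simps)
    have "bloch_seminorm \<nu> ?g \<le> 1 - cmod (g 0)"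
      using le d by (intro bloch_seminorm_le) (auto simp: algebra_simps)
    then show "bloch_norm \<nu> ?g \<le> 1" by (simp add: bloch_norm_def)
    show "strict_mono (r \<circ> s)" using r s by (rule strict_mono_o)
    show "(\<lambda>n. f ((r \<circ> s) n) z) \<longlonglongrightarrow> ?g z" if "z \<in> unit_disk" for z
      using LIMSEQ_subseq_LIMSEQ[OF lim[OF that] s] that by (simp add: o_def)
    show "uniform_limit K (\<lambda>n. deriv (f ((r \<circ> s) n))) (deriv ?g) sequentially"
      if "compact K" "K \<subseteq> unit_disk" for K
      using unif'[OF that] by (rule uniform_limit_cong'[THEN iffD1, rotated 2]) (use that d in auto)
  qed
qed

text \<open>Norm convergence in a Bloch space implies pointwise convergence of derivatives. Hence a limit
  point of the images has derivative \<open>0\<close>, which leaves no room for a subsequence whose seminorms stay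
  away from \<open>0\<close>.\<close>

lemma compact_comp_op_null:
  assumes \<mu>: "disk_weight \<mu>" and \<phi>: "\<phi> holomorphic_on unit_disk" "\<phi> ` unit_disk \<subseteq> unit_disk"
    and comp: "bloch_compact_operator \<nu> \<mu> (comp_op \<phi>)"
    and f: "\<And>n. f n \<in> bloch_space \<nu>" "\<And>n. bloch_norm \<nu> (f n) \<le> 1"
    and lim: "\<And>z. z \<in> unit_disk \<Longrightarrow> (\<lambda>n. deriv (f n) z) \<longlonglongrightarrow> 0"
  shows "(\<lambda>n. bloch_seminorm \<mu> (comp_op \<phi> (f n))) \<longlonglongrightarrow> 0"
proof (rule ccontr)
  interpret Metric_space "bloch_space \<mu>" "bloch_dist \<mu>" by (rule Metric_space_bloch[OF \<mu>])
  let ?T = "comp_op \<phi>" and ?B = "{f \<in> bloch_space \<nu>. bloch_norm \<nu> f \<le> 1}"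
  let ?a = "\<lambda>n. bloch_seminorm \<mu> (?T (f n))"
  have T: "?T h \<in> bloch_space \<mu>" if "h \<in> bloch_space \<nu>" for h
    using comp that by (auto simp: bloch_compact_operator_def)
  have a_nonneg: "0 \<le> ?a n" for n
    using T[OF f(1)] by (intro bloch_seminorm_nonneg[OF \<mu>]) (auto simp: bloch_space_def)
  assume "\<not> ?a \<longlonglongrightarrow> 0"
  then obtain e where e: "0 < e" "\<exists>\<^sub>F n in sequentially. e \<le> ?a n"
    using a_nonneg by (auto simp: tendsto_iff not_eventually not_less)
  then have "infinite {n. e \<le> ?a n}"
    by (simp add: frequently_cofinite cofinite_eq_sequentially[symmetric])
  then obtain p :: "nat \<Rightarrow> nat" where p: "strict_mono p" "\<And>n. e \<le> ?a (p n)"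
    using infinite_enumerate[of "{n. e \<le> ?a n}"] by auto
  let ?C = "mtopology closure_of (?T ` ?B)"
  have cC: "compactin mtopology ?C"
    using comp by (simp add: bloch_compact_operator_def bloch_topology_def)
  have "?T ` ?B \<subseteq> ?C" by (rule closure_of_subset) (use T in auto)
  then have "range (\<lambda>n. ?T (f (p n))) \<subseteq> ?C" using f by blast
  then obtain l q where q: "strict_mono q"
      and l: "limitin mtopology ((\<lambda>n. ?T (f (p n))) \<circ> q) l sequentially"
    using cC unfolding compactin_sequentially by blast
  let ?s = "\<lambda>n. p (q n)"
  have lM: "l \<in> bloch_space \<mu>" and d0: "(\<lambda>n. bloch_dist \<mu> (?T (f (?s n))) l) \<longlonglongrightarrow> 0"
    using l by (auto simp: limitin_metric_dist_null o_def)
  have dist_ge: "\<mu> z * cmod (deriv (?T (f k)) z - deriv l z) \<le> bloch_dist \<mu> (?T (f k)) l"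
    if z: "z \<in> unit_disk" for z k
    using bloch_seminorm_ge[OF bloch_finite_diff[OF \<mu> T[OF f(1)] lM] z, of k]
      bloch_deriv_diff[OF T[OF f(1)] lM z, of k] T[OF f(1), of k] lM
    by (simp add: bloch_dist_def bloch_norm_def add_increasing)
  have s: "strict_mono ?s" using strict_mono_o[OF p(1) q] by (simp add: o_def)
  have dl: "deriv l z = 0" if z: "z \<in> unit_disk" for z
  proof -
    have pz: "\<phi> z \<in> unit_disk" using \<phi> z by blast
    have "(\<lambda>n. deriv (?T (f n)) z) \<longlonglongrightarrow> 0"
      using tendsto_mult_right[OF lim[OF pz], of "deriv \<phi> z"]
      by (simp add: deriv_comp_op[OF \<phi> bloch_space_holomorphic[OF f(1)] z])
    then have "(\<lambda>n. deriv (?T (f (?s n))) z) \<longlonglongrightarrow> 0"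
      using LIMSEQ_subseq_LIMSEQ[OF _ s] by (force simp: o_def)
    then have "(\<lambda>n. \<mu> z * cmod (deriv (?T (f (?s n))) z - deriv l z)) \<longlonglongrightarrow> \<mu> z * cmod (0 - deriv l z)"
      by (intro tendsto_intros)
    from LIMSEQ_le[OF this d0] have "\<mu> z * cmod (deriv l z) \<le> 0"
      using dist_ge[OF z] by auto
    moreover have "0 < \<mu> z" using \<mu> z by (auto simp: disk_weight_def)
    ultimately show ?thesis by (simp add: mult_le_0_iff)
  qed
  have "e \<le> bloch_dist \<mu> (?T (f (?s n))) l" for n
  proof -
    have "?a (?s n) \<le> bloch_dist \<mu> (?T (f (?s n))) l"
      using dist_ge dl by (intro bloch_seminorm_le) simp
    then show ?thesis using p(2)[of "q n"] by linarith
  qed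
  then have "e \<le> 0" using LIMSEQ_le_const[OF d0] by blast
  with e(1) show False by simp
qed

text \<open>The image of the unit ball is itself sequentially compact. For a sequence \<open>f\<^sub>n\<close> in the ball with
  limit \<open>g\<close> as in \<open>bloch_ball_normal\<close>, the quantity \<open>\<mu> \<bar>\<phi>'\<bar> \<bar>f\<^sub>n' - g'\<bar>(\<phi>)\<close> is at most
  \<open>\<epsilon> \<nu>(\<phi>) \<bar>f\<^sub>n' - g'\<bar>(\<phi>) \<le> 2 \<epsilon>\<close> where \<open>\<phi>\<close> is near the circle; elsewhere \<open>\<mu> \<bar>\<phi>'\<bar>\<close> is bounded and
  \<open>f\<^sub>n' - g'\<close> is uniformly small.\<close>

lemma comp_op_compact_if_vanishing:
  assumes \<nu>: "disk_weight \<nu>" and \<mu>: "disk_weight \<mu>"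
    and \<phi>: "\<phi> holomorphic_on unit_disk" "\<phi> ` unit_disk \<subseteq> unit_disk"
    and T: "\<And>f. f \<in> bloch_space \<nu> \<Longrightarrow> comp_op \<phi> f \<in> bloch_space \<mu>"
    and van: "\<And>\<epsilon>::real. 0 < \<epsilon> \<Longrightarrow>
      \<exists>\<rho><1. \<forall>z\<in>unit_disk. \<rho> < cmod (\<phi> z) \<longrightarrow> \<mu> z * cmod (deriv \<phi> z) \<le> \<epsilon> * \<nu> (\<phi> z)"
  shows "bloch_compact_operator \<nu> \<mu> (comp_op \<phi>)"
proof -
  interpret Metric_space "bloch_space \<mu>" "bloch_dist \<mu>" by (rule Metric_space_bloch[OF \<mu>])
  let ?T = "comp_op \<phi>" and ?B = "{f \<in> bloch_space \<nu>. bloch_norm \<nu> f \<le> 1}"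
  have \<mu>pos: "0 < \<mu> z" and \<nu>pos: "0 < \<nu> z" if "z \<in> unit_disk" for z
    using \<mu> \<nu> that by (auto simp: disk_weight_def)
  \<comment> \<open>As the identity lies in the domain space, \<open>\<mu> \<bar>\<phi>'\<bar>\<close> is bounded on the whole disk.\<close>
  obtain D where D: "0 < D" "\<And>z. z \<in> unit_disk \<Longrightarrow> \<mu> z * cmod (deriv \<phi> z) \<le> D"
  proof -
    obtain b where b: "\<And>z. z \<in> unit_disk \<Longrightarrow> \<bar>\<nu> z\<bar> \<le> b"
      using \<nu> unfolding disk_weight_def bounded_iff by (metis image_eqI real_norm_def)
    let ?i = "restrict (\<lambda>z. z) unit_disk"
    have "?i \<in> bloch_space \<nu>"
      using b by (intro restrict_in_bloch_space[where B = b]) (auto intro: order_trans[OF abs_ge_self])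
    then have i: "?T ?i \<in> bloch_space \<mu>" by (rule T)
    have "\<mu> z * cmod (deriv \<phi> z) \<le> bloch_seminorm \<mu> (?T ?i)" if z: "z \<in> unit_disk" for z
    proof -
      have "deriv (?T ?i) z = deriv \<phi> z"
        using z \<phi>(2) by (intro deriv_cong_disk) (auto simp: comp_op_def image_subset_iff)
      then show ?thesis using bloch_space_deriv_le[OF i z] by simp
    qed
    then show ?thesis
      by (intro that[of "max 1 (bloch_seminorm \<mu> (?T ?i))"]) (auto intro: max.coboundedI2)
  qed
  have "compactin mtopology (?T ` ?B)"
    unfolding compactin_sequentially
  proof (intro conjI allI impI)
    show "?T ` ?B \<subseteq> bloch_space \<mu>" using T by auto
    fix \<sigma> :: "nat \<Rightarrow> complex \<Rightarrow> complex" assume "range \<sigma> \<subseteq> ?T ` ?B"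
    then have "\<forall>n. \<exists>h. h \<in> ?B \<and> \<sigma> n = ?T h" by blast
    then obtain f where f: "\<And>n. f n \<in> bloch_space \<nu>" "\<And>n. bloch_norm \<nu> (f n) \<le> 1"
      and \<sigma>: "\<And>n. \<sigma> n = ?T (f n)" by (auto dest!: choice)
    obtain g r where g: "g \<in> bloch_space \<nu>" "bloch_norm \<nu> g \<le> 1" and r: "strict_mono r"
      and lim: "\<And>z. z \<in> unit_disk \<Longrightarrow> (\<lambda>n. f (r n) z) \<longlonglongrightarrow> g z"
      and unif: "\<And>K. compact K \<Longrightarrow> K \<subseteq> unit_disk \<Longrightarrow>
                   uniform_limit K (\<lambda>n. deriv (f (r n))) (deriv g) sequentially"
      by (rule bloch_ball_normal[OF \<nu> f]) (rule that)
    have "(\<lambda>n. bloch_seminorm \<mu> (\<lambda>z. ?T (f (r n)) z - ?T g z)) \<longlonglongrightarrow> 0"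
    proof (rule LIMSEQ_I)
      fix e :: real assume e: "0 < e"
      obtain \<rho> where \<rho>: "\<rho> < 1" "\<And>z. z \<in> unit_disk \<Longrightarrow> \<rho> < cmod (\<phi> z) \<Longrightarrow>
          \<mu> z * cmod (deriv \<phi> z) \<le> e / 4 * \<nu> (\<phi> z)"
        using van[of "e / 4"] e by auto
      have "uniform_limit (cball 0 \<rho>) (\<lambda>n. deriv (f (r n))) (deriv g) sequentially"
        using \<rho>(1) by (intro unif) auto
      moreover have "0 < e / (2 * D)" using e D(1) by simp
      ultimately have "\<forall>\<^sub>F n in sequentially. \<forall>w\<in>cball 0 \<rho>.
          dist (deriv (f (r n)) w) (deriv g w) < e / (2 * D)"
        by (rule uniform_limitD)
      then obtain N where N: "\<And>n w. n \<ge> N \<Longrightarrow> w \<in> cball 0 \<rho> \<Longrightarrow>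
          cmod (deriv (f (r n)) w - deriv g w) < e / (2 * D)"
        unfolding eventually_sequentially dist_norm by blast
      have "bloch_seminorm \<mu> (\<lambda>z. ?T (f (r n)) z - ?T g z) \<le> e / 2" if n: "n \<ge> N" for n
      proof (rule bloch_seminorm_le)
        fix z assume z: "z \<in> unit_disk"
        let ?d = "cmod (deriv (f (r n)) (\<phi> z) - deriv g (\<phi> z))" and ?m = "\<mu> z * cmod (deriv \<phi> z)"
        have pz: "\<phi> z \<in> unit_disk" using \<phi> z by blast
        have m0: "0 \<le> ?m" using \<mu>pos[OF z] by simp
        have "deriv (\<lambda>z. ?T (f (r n)) z - ?T g z) z
            = (deriv (f (r n)) (\<phi> z) - deriv g (\<phi> z)) * deriv \<phi> z"
          unfolding bloch_deriv_diff[OF T[OF f(1)] T[OF g(1)] z]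
          by (simp add: deriv_comp_op[OF \<phi> bloch_space_holomorphic[OF f(1)] z]
              deriv_comp_op[OF \<phi> bloch_space_holomorphic[OF g(1)] z] left_diff_distrib)
        then have eq: "\<mu> z * cmod (deriv (\<lambda>z. ?T (f (r n)) z - ?T g z) z) = ?m * ?d"
          by (simp add: norm_mult)
        have "?m * ?d \<le> e / 2"
        proof (cases "\<rho> < cmod (\<phi> z)")
          case True
          have "\<nu> (\<phi> z) * cmod (deriv h (\<phi> z)) \<le> 1" if "h \<in> bloch_space \<nu>" "bloch_norm \<nu> h \<le> 1" for h
            using bloch_space_deriv_le[OF that(1) pz] that(2) norm_ge_zero[of "h 0"]
            unfolding bloch_norm_def by linarith
          from this[OF f(1) f(2), of "r n"] this[OF g] have "\<nu> (\<phi> z) * ?d \<le> 2"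
            using mult_left_mono[OF norm_triangle_ineq4[of "deriv (f (r n)) (\<phi> z)" "deriv g (\<phi> z)"],
                of "\<nu> (\<phi> z)"] \<nu>pos[OF pz] by (simp add: distrib_left)
          then have "e / 4 * (\<nu> (\<phi> z) * ?d) \<le> e / 4 * 2"
            using e by (intro mult_left_mono) auto
          moreover have "?m * ?d \<le> e / 4 * \<nu> (\<phi> z) * ?d"
            using \<rho>(2)[OF z True] by (intro mult_right_mono) auto
          ultimately show ?thesis by (simp add: mult.assoc)
        next
          case False
          then have "?d < e / (2 * D)" using N[OF n, of "\<phi> z"] by simp
          then have "?m * ?d \<le> D * (e / (2 * D))"
            using D z m0 e by (intro mult_mono) auto
          then show ?thesis using D(1) by simp
        qed
        then show "\<mu> z * cmod (deriv (\<lambda>z. ?T (f (r n)) z - ?T g z) z) \<le> e / 2" by (simp only: eq)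
      qed
      moreover have "0 \<le> bloch_seminorm \<mu> (\<lambda>z. ?T (f (r n)) z - ?T g z)" for n
        by (intro bloch_seminorm_nonneg[OF \<mu>] bloch_finite_diff[OF \<mu>] T f g)
      ultimately have "\<forall>n\<ge>N. norm (bloch_seminorm \<mu> (\<lambda>z. ?T (f (r n)) z - ?T g z) - 0) < e"
        using e by (force intro: le_less_trans)
      then show "\<exists>N. \<forall>n\<ge>N. norm (bloch_seminorm \<mu> (\<lambda>z. ?T (f (r n)) z - ?T g z) - 0) < e" ..
    qed
    moreover have "(\<lambda>n. cmod (?T (f (r n)) 0 - ?T g 0)) \<longlonglongrightarrow> 0"
    proof -
      have "\<phi> 0 \<in> unit_disk" using \<phi>(2) by force
      then have "(\<lambda>n. cmod (f (r n) (\<phi> 0) - g (\<phi> 0))) \<longlonglongrightarrow> cmod (g (\<phi> 0) - g (\<phi> 0))"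
        by (intro tendsto_intros lim)
      then show ?thesis by (simp add: comp_op_def)
    qed
    ultimately have "(\<lambda>n. cmod (?T (f (r n)) 0 - ?T g 0)
        + bloch_seminorm \<mu> (\<lambda>z. ?T (f (r n)) z - ?T g z)) \<longlonglongrightarrow> 0 + 0"
      by (intro tendsto_add)
    then have "(\<lambda>n. bloch_dist \<mu> (?T (f (r n))) (?T g)) \<longlonglongrightarrow> 0"
      by (simp add: bloch_dist_def bloch_norm_def T f g)
    then have "limitin mtopology (\<sigma> \<circ> r) (?T g) sequentially"
      by (simp add: limitin_metric_dist_null \<sigma> T f g)
    then show "\<exists>l r. l \<in> ?T ` ?B \<and> strict_mono r \<and> limitin mtopology (\<sigma> \<circ> r) l sequentially"
      using g r by blast
  qed
  moreover from this have "mtopology closure_of (?T ` ?B) = ?T ` ?B"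
    by (intro closure_of_closedin compactin_imp_closedin Hausdorff_space_mtopology)
  ultimately show ?thesis
    using T by (auto simp: bloch_compact_operator_def bloch_topology_def)
qed

section \<open>The logarithmic weight\<close>

text \<open>The weight as a function of \<open>t = 1 - \<bar>z\<bar>\<close>. The constant \<open>3\<close> exceeds \<open>e\<close>, which makes \<open>ln (3 / t) \<ge> 1\<close>
  and thereby outweighs the term \<open>s ln (t / s) \<le> t - s\<close>.\<close>

lemma mult_ln_mono:
  fixes s t :: real
  assumes "0 < s" "s \<le> t" "t \<le> 1"
  shows "s * ln (3 / s) \<le> t * ln (3 / t)"
proof -
  have "exp 1 \<le> 3 / t"
    using exp_le assms by (intro order_trans[OF exp_le]) (simp add: field_simps)
  then have ln1: "1 \<le> ln (3 / t)" using assms by (simp add: ln_ge_iff)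
  have "3 / s = (3 / t) * (t / s)" using assms by simp
  then have "ln (3 / s) = ln (3 / t) + ln (t / s)" using assms by (simp add: ln_mult ln_div)
  then have "s * ln (3 / s) = s * ln (3 / t) + s * ln (t / s)" by (simp add: distrib_left)
  also have "s * ln (t / s) \<le> s * (t / s - 1)"
    using assms by (intro mult_left_mono ln_le_minus_one) auto
  also have "s * (t / s - 1) = (t - s) * 1" using assms by (simp add: field_simps)
  also have "(t - s) * 1 \<le> (t - s) * ln (3 / t)" using assms ln1 by (intro mult_left_mono) auto
  finally show ?thesis by (simp add: algebra_simps)
qed

lemma disk_weight_v_log: "disk_weight v_log"
proof -
  have pos: "0 < v_log z" if "z \<in> unit_disk" for z
  proof -
    have "0 < 1 - cmod z" "1 - cmod z < 3" using that norm_ge_zero[of z] by (simp, linarith)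
    then show ?thesis unfolding v_log_def by (intro mult_pos_pos ln_gt_zero) auto
  qed
  have "v_log z \<le> ln 3" if "z \<in> unit_disk" for z
    using mult_ln_mono[of "1 - cmod z" 1] that by (simp add: v_log_def)
  then have "bounded (v_log ` unit_disk)"
    using pos unfolding bounded_iff by (auto simp: less_imp_le intro!: exI[of _ "ln 3"])
  moreover have "continuous_on unit_disk v_log"
    unfolding v_log_def by (intro continuous_intros) auto
  ultimately show ?thesis using pos by (auto simp: disk_weight_def)
qed

text \<open>With \<open>m = j - 1\<close> this is \<open>(1 + 1 / m)\<^sup>m \<le> e\<close> in reciprocal form. It bounds \<open>r\<^bsup>j-1\<^esup>\<close> from below at
  radii within \<open>1 / j\<close> of the circle.\<close>

lemma exp_minus_one_le_power:
  fixes r :: real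
  assumes "1 \<le> j" "1 - 1 / real j \<le> r"
  shows "exp (-1) \<le> r ^ (j - 1)"
proof -
  have "exp (-1) \<le> (1 - 1 / real j) ^ (j - 1)"
  proof (cases "j = 1")
    case False
    define m where "m = j - 1"
    have m: "0 < m" "real j = real m + 1" using False assms(1) by (auto simp: m_def)
    have "1 + 1 / real m \<le> exp (1 / real m)" by (rule exp_ge_add_one_self)
    then have "inverse (exp (1 / real m)) \<le> inverse (1 + 1 / real m)"
      by (rule le_imp_inverse_le) (use m in \<open>auto intro: add_pos_pos\<close>)
    also have "inverse (1 + 1 / real m) = 1 - 1 / real j" using m by (simp add: field_simps)
    finally have "exp (- (1 / real m)) \<le> 1 - 1 / real j" by (simp add: exp_minus)
    then have "exp (- (1 / real m)) ^ m \<le> (1 - 1 / real j) ^ m" by (intro power_mono) auto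
    moreover have "exp (- (1 / real m)) ^ m = exp (-1)" using m by (simp flip: exp_of_nat_mult)
    ultimately show ?thesis by (simp add: m_def)
  qed simp
  also have "\<dots> \<le> r ^ (j - 1)" using assms by (intro power_mono) (auto simp: field_simps)
  finally show ?thesis .
qed

text \<open>Every term of \<open>1 + r + \<dots> + r\<^bsup>j-1\<^esup> = (1 - r\<^sup>j) / (1 - r)\<close> is at least the last one.\<close>

lemma mult_power_mult_le_one:
  fixes r :: real
  assumes "0 \<le> r" "r \<le> 1"
  shows "real j * r ^ (j - 1) * (1 - r) \<le> 1"
proof -
  have "real j * r ^ (j - 1) = (\<Sum>k<j. r ^ (j - 1))" by simp
  also have "\<dots> \<le> (\<Sum>k<j. r ^ k)" using assms by (intro sum_mono power_decreasing) auto
  finally have "real j * r ^ (j - 1) * (1 - r) \<le> (\<Sum>k<j. r ^ k) * (1 - r)"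
    using assms by (intro mult_right_mono) auto
  also have "\<dots> = 1 - r ^ j" by (simp add: one_diff_power_eq mult.commute)
  also have "\<dots> \<le> 1" using assms by simp
  finally show ?thesis .
qed

text \<open>For \<open>t = 1 - \<bar>z\<bar> \<ge> 1 / (j + 1)\<close> the logarithm is at most \<open>ln (3 (j + 1))\<close> and the other factors
  multiply to at most \<open>1\<close>. For smaller \<open>t\<close>, monotonicity of \<open>t ln (3 / t)\<close> reduces to
  \<open>t = 1 / (j + 1)\<close>.\<close>

lemma v_log_monomial_le:
  assumes j: "1 \<le> j" and z: "z \<in> unit_disk"
  shows "v_log z * cmod (deriv (\<lambda>z. z ^ j) z) \<le> 3 * ln (real j + 1)"
proof -
  define r where "r = cmod z"
  define t where "t = 1 - r"
  have r: "0 \<le> r" "r < 1" using z by (auto simp: r_def)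
  then have t: "0 < t" "t \<le> 1" by (auto simp: t_def)
  let ?p = "real j * r ^ (j - 1)"
  \<comment> \<open>Since \<open>3 \<le> 2\<^sup>2\<close>, the constant \<open>ln 3\<close> is absorbed for \<open>j \<ge> 1\<close>.\<close>
  have ln3: "ln (3 * (real j + 1)) \<le> 3 * ln (real j + 1)"
  proof -
    have "ln (3::real) \<le> ln (2 ^ 2)" by (intro ln_mono) auto
    also have "\<dots> = 2 * ln 2" by (subst ln_realpow) auto
    also have "\<dots> \<le> 2 * ln (real j + 1)" using j by (intro mult_left_mono ln_mono) auto
    finally have "ln 3 \<le> 2 * ln (real j + 1)" .
    moreover have "ln (3 * (real j + 1)) = ln 3 + ln (real j + 1)" by (rule ln_mult_pos) auto
    ultimately show ?thesis by linarith
  qed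
  have l0: "0 \<le> ln (3 * (real j + 1))" by (intro ln_ge_zero) auto
  have p0: "0 \<le> ?p" using r by simp
  have "?p * (t * ln (3 / t)) \<le> ln (3 * (real j + 1))"
  proof (cases "1 \<le> t * (real j + 1)")
    case True
    then have "3 / t \<le> 3 * (real j + 1)" using t by (simp add: field_simps)
    then have "ln (3 / t) \<le> ln (3 * (real j + 1))" using t by (intro ln_mono) auto
    then have "?p * t * ln (3 / t) \<le> ?p * t * ln (3 * (real j + 1))"
      using p0 t by (intro mult_left_mono) auto
    also have "\<dots> \<le> 1 * ln (3 * (real j + 1))"
      using mult_power_mult_le_one[of r j] r l0 by (intro mult_right_mono) (auto simp: t_def)
    finally show ?thesis by (simp add: mult.assoc)
  next
    case False
    then have "t \<le> 1 / (real j + 1)" by (simp add: field_simps)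
    then have "t * ln (3 / t) \<le> 1 / (real j + 1) * ln (3 / (1 / (real j + 1)))"
      using t by (intro mult_ln_mono) auto
    moreover have "?p \<le> real j + 1" using mult_left_le[of "r ^ (j - 1)" "real j"] power_le_one[of r "j - 1"] r by simp
    moreover have "0 \<le> t * ln (3 / t)" using t by (intro mult_nonneg_nonneg ln_ge_zero) auto
    ultimately have "?p * (t * ln (3 / t)) \<le> (real j + 1) * (1 / (real j + 1) * ln (3 / (1 / (real j + 1))))"
      by - (rule mult_mono, auto)
    then show ?thesis by simp
  qed
  then show ?thesis
    using ln3 by (simp add: v_log_def deriv_monomial norm_mult norm_power t_def r_def mult.commute mult.left_commute)
qed

lemma monomial_in_log_bloch:
  assumes "1 \<le> j"
  shows "bloch_finite v_log (\<lambda>z. z ^ j)" "bloch_seminorm v_log (\<lambda>z. z ^ j) \<le> 3 * ln (real j + 1)"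
  using v_log_monomial_le[OF assms] by (auto simp: bloch_finite_def intro!: bdd_aboveI2 bloch_seminorm_le)

text \<open>The supremum is tested at the real point \<open>1 - 1 / j\<close>, where \<open>j (1 - \<bar>z\<bar>) = 1\<close>.\<close>

lemma log_le_bloch_seminorm_monomial:
  assumes j: "1 \<le> j"
  shows "exp (-1) * ln (real j + 1) \<le> bloch_seminorm v_log (\<lambda>z. z ^ j)"
proof -
  let ?r = "1 - 1 / real j"
  let ?z = "complex_of_real ?r"
  have r: "0 \<le> ?r" "?r < 1" using j by auto
  then have nz: "cmod ?z = ?r" by (simp only: norm_of_real abs_of_nonneg)
  then have z: "?z \<in> unit_disk" using r by simp
  have "exp (-1) * ln (real j + 1) \<le> ?r ^ (j - 1) * ln (3 * real j)"
    using j exp_minus_one_le_power[OF j order_refl] r by (intro mult_mono ln_mono ln_ge_zero) auto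
  also have "\<dots> = v_log ?z * cmod (deriv (\<lambda>z. z ^ j) ?z)"
    using j by (simp only: v_log_def deriv_monomial norm_mult norm_power norm_of_nat nz) simp
  also have "\<dots> \<le> bloch_seminorm v_log (\<lambda>z. z ^ j)"
    by (rule bloch_seminorm_ge[OF monomial_in_log_bloch(1)[OF j] z])
  finally show ?thesis .
qed

lemma bloch_seminorm_monomial_pos:
  assumes "1 \<le> j"
  shows "0 < bloch_seminorm v_log (\<lambda>z. z ^ j)"
proof -
  have "0 < exp (-1) * ln (real j + 1)" using assms by (intro mult_pos_pos) auto
  also have "\<dots> \<le> bloch_seminorm v_log (\<lambda>z. z ^ j)" by (rule log_le_bloch_seminorm_monomial[OF assms])
  finally show ?thesis .
qed

section \<open>Powers of the symbol\<close>

text \<open>At a given \<open>z\<close> only one exponent is used, \<open>j = \<lfloor>1 / t\<rfloor>\<close> with \<open>t = 1 - \<bar>\<phi> z\<bar>\<close>. It satisfies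
  \<open>t \<le> 1 / j\<close>, so that \<open>\<bar>\<phi> z\<bar>\<^bsup>j-1\<^esup> \<ge> 1 / e\<close>, and \<open>j \<ge> 1 / (2 t)\<close>, so that the derivative of \<open>\<phi>\<^sup>j\<close> at
  \<open>z\<close> has modulus at least \<open>\<bar>\<phi>' z\<bar> / (2 e t)\<close>. As \<open>\<phi> z\<close> approaches the circle, \<open>j\<close> grows without
  bound and the limit hypothesis applies.\<close>

lemma power_seminorm_log_vanishing:
  assumes \<mu>: "disk_weight \<mu>" and \<phi>: "\<phi> holomorphic_on unit_disk" "\<phi> ` unit_disk \<subseteq> unit_disk"
    and fin: "\<And>j. 1 \<le> j \<Longrightarrow> bloch_finite \<mu> (\<lambda>z. \<phi> z ^ j)"
    and lim: "(\<lambda>j. bloch_seminorm \<mu> (\<lambda>z. \<phi> z ^ j) / ln (real j + 1)) \<longlonglongrightarrow> 0"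
    and \<epsilon>: "0 < (\<epsilon>::real)"
  shows "\<exists>\<rho><1. \<forall>z\<in>unit_disk. \<rho> < cmod (\<phi> z) \<longrightarrow> \<mu> z * cmod (deriv \<phi> z) \<le> \<epsilon> * v_log (\<phi> z)"
proof -
  \<comment> \<open>This compensates the factor \<open>1 / (2 e)\<close> lost in the lower bound for the derivative of \<open>\<phi>\<^sup>j\<close>.\<close>
  define d where "d = \<epsilon> * exp (-1) / 2"
  have d: "0 < d" using \<epsilon> by (simp add: d_def)
  obtain J where J: "\<And>j. j \<ge> J \<Longrightarrow> \<bar>bloch_seminorm \<mu> (\<lambda>z. \<phi> z ^ j) / ln (real j + 1)\<bar> < d"
    using LIMSEQ_D[OF lim d] by auto
  have "\<mu> z * cmod (deriv \<phi> z) \<le> \<epsilon> * v_log (\<phi> z)"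
    if z: "z \<in> unit_disk" and large: "1 - 1 / (real J + 1) < cmod (\<phi> z)" for z
  proof -
    define r where "r = cmod (\<phi> z)"
    define t where "t = 1 - r"
    define j where "j = nat \<lfloor>1 / t\<rfloor>"
    let ?m = "\<mu> z * cmod (deriv \<phi> z)"
    have "\<phi> z \<in> unit_disk" using \<phi> z by blast
    then have r: "0 \<le> r" "r < 1" by (auto simp: r_def)
    then have t: "0 < t" "t \<le> 1" by (auto simp: t_def)
    have "t < 1 / (real J + 1)" using large by (simp add: t_def r_def)
    then have "real J + 1 < 1 / t" using t by (simp add: field_simps)
    then have jJ: "j \<ge> J + 1" unfolding j_def by linarith
    have jt: "real j \<le> 1 / t" "1 / t < real j + 1"
      using t unfolding j_def by (auto simp: of_nat_nat)
    have j1: "1 \<le> j" using jJ by simp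
    have m0: "0 \<le> ?m" using \<mu> z by (auto simp: disk_weight_def less_imp_le)
    have "t \<le> 1 / real j" using jt(1) t j1 by (simp add: field_simps)
    then have pw: "exp (-1) \<le> r ^ (j - 1)" by (intro exp_minus_one_le_power[OF j1]) (simp add: t_def)
    have "1 / t \<le> 2 * real j" using jt(2) j1 by linarith
    then have "1 / (2 * t) \<le> real j" by simp
    then have "1 / (2 * t) * exp (-1) \<le> real j * r ^ (j - 1)" using pw by (intro mult_mono) auto
    then have "?m * (1 / (2 * t) * exp (-1)) \<le> ?m * (real j * r ^ (j - 1))"
      using m0 by (rule mult_left_mono)
    also have "\<dots> = \<mu> z * cmod (deriv (\<lambda>z. \<phi> z ^ j) z)"
      by (simp add: deriv_power_disk[OF \<phi>(1) z] norm_mult norm_power r_def)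
    also have "\<dots> \<le> bloch_seminorm \<mu> (\<lambda>z. \<phi> z ^ j)"
      using fin[OF j1] z by (rule bloch_seminorm_ge)
    also have "\<dots> \<le> d * ln (real j + 1)"
    proof -
      have "0 < ln (real j + 1)" using j1 by simp
      then show ?thesis using J[of j] jJ by (auto simp: abs_less_iff field_simps)
    qed
    also have "\<dots> \<le> d * ln (3 / t)"
    proof -
      have "real j + 1 \<le> 1 / t + 1 / t" using jt(1) t by (intro add_mono) auto
      also have "\<dots> \<le> 3 / t" using t by (simp add: field_simps)
      finally show ?thesis using d j1 by (intro mult_left_mono ln_mono) auto
    qed
    finally have "?m * (1 / (2 * t) * exp (-1)) * (2 * t) \<le> d * ln (3 / t) * (2 * t)"
      using t by (intro mult_right_mono) auto
    then have "?m * exp (-1) \<le> \<epsilon> * (t * ln (3 / t)) * exp (-1)"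
      using t by (simp add: d_def mult_ac)
    then show ?thesis by (simp add: v_log_def t_def r_def)
  qed
  then show ?thesis by (intro exI[of _ "1 - 1 / (real J + 1)"]) auto
qed

lemma bloch_finite_power_symbol:
  assumes \<phi>: "\<phi> ` unit_disk \<subseteq> unit_disk"
    and T: "\<And>f. f \<in> bloch_space v_log \<Longrightarrow> comp_op \<phi> f \<in> bloch_space \<mu>"
    and j: "1 \<le> j"
  shows "bloch_finite \<mu> (\<lambda>z. \<phi> z ^ j)"
proof -
  let ?F = "restrict (\<lambda>z. z ^ j) unit_disk"
  have "?F \<in> bloch_space v_log"
    using v_log_monomial_le[OF j] by (intro restrict_in_bloch_space) (auto intro!: holomorphic_intros)
  then have F: "comp_op \<phi> ?F \<in> bloch_space \<mu>" by (rule T)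
  have "deriv (comp_op \<phi> ?F) z = deriv (\<lambda>z. \<phi> z ^ j) z" if "z \<in> unit_disk" for z
    using that \<phi> by (intro deriv_cong_disk) (auto simp: comp_op_def image_subset_iff)
  then have "bloch_finite \<mu> (\<lambda>z. \<phi> z ^ j) \<longleftrightarrow> bloch_finite \<mu> (comp_op \<phi> ?F)"
    unfolding bloch_finite_def by (intro arg_cong[where f = bdd_above] image_cong) simp_all
  then show ?thesis using F by (simp add: bloch_space_def)
qed

text \<open>The normalised monomials lie in the unit ball and their derivatives tend to \<open>0\<close> pointwise: the
  monomial seminorms are bounded below and \<open>(n + 1) z\<^sup>n \<longlonglongrightarrow> 0\<close>. The quotients in question are
  bounded by the seminorms of their images.\<close>

lemma compact_comp_op_monomials:
  assumes \<mu>: "disk_weight \<mu>" and \<phi>: "\<phi> holomorphic_on unit_disk" "\<phi> ` unit_disk \<subseteq> unit_disk"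
    and fin: "\<And>j. 1 \<le> j \<Longrightarrow> bloch_finite \<mu> (\<lambda>z. \<phi> z ^ j)"
    and comp: "bloch_compact_operator v_log \<mu> (comp_op \<phi>)"
  shows "(\<lambda>j. bloch_seminorm \<mu> (\<lambda>z. \<phi> z ^ j) / bloch_seminorm v_log (\<lambda>z. z ^ j)) \<longlonglongrightarrow> 0"
proof -
  let ?a = "\<lambda>j::nat. bloch_seminorm \<mu> (\<lambda>z. \<phi> z ^ j)"
  let ?N = "\<lambda>j::nat. bloch_seminorm v_log (\<lambda>z. z ^ j)"
  note N = bloch_seminorm_monomial_pos
  \<comment> \<open>The index is shifted because the constant monomial has seminorm \<open>0\<close>.\<close>
  define f where "f = (\<lambda>n. restrict (\<lambda>z. z ^ Suc n / of_real (?N (Suc n))) unit_disk)"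
  have df: "deriv (f n) z = of_nat (Suc n) * z ^ n / of_real (?N (Suc n))" if "z \<in> unit_disk" for n z
  proof -
    have "deriv (f n) z = deriv (\<lambda>z. z ^ Suc n / of_real (?N (Suc n))) z"
      using that by (intro deriv_cong_disk) (auto simp: f_def)
    also have "\<dots> = of_nat (Suc n) * z ^ n / of_real (?N (Suc n))"
      by (subst deriv_cdivide_right) (auto simp: deriv_monomial simp del: power_Suc
          intro!: derivative_intros)
    finally show ?thesis .
  qed
  have le1: "v_log z * cmod (deriv (f n) z) \<le> 1" if z: "z \<in> unit_disk" for n z
  proof -
    have "v_log z * cmod (deriv (\<lambda>z. z ^ Suc n) z) \<le> ?N (Suc n)"
      using monomial_in_log_bloch(1)[of "Suc n"] z by (intro bloch_seminorm_ge) auto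
    then show ?thesis
      using N[of "Suc n"] unfolding df[OF z] deriv_monomial by (simp add: norm_mult norm_divide)
  qed
  have f_in: "f n \<in> bloch_space v_log" for n
  proof -
    have "(\<lambda>z. z ^ Suc n / of_real (?N (Suc n))) holomorphic_on unit_disk"
      using N[of "Suc n"] by (intro holomorphic_intros) auto
    then have "f n holomorphic_on unit_disk"
      by (rule holomorphic_transform) (simp add: f_def)
    then have "restrict (f n) unit_disk \<in> bloch_space v_log"
      by (rule restrict_in_bloch_space[OF _ le1])
    then show ?thesis by (simp add: f_def)
  qed
  have f_norm: "bloch_norm v_log (f n) \<le> 1" for n
    using bloch_seminorm_le[of v_log "f n" 1, OF le1] by (simp add: bloch_norm_def f_def)
  have "(\<lambda>n. deriv (f n) z) \<longlonglongrightarrow> 0" if z: "z \<in> unit_disk" for z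
  proof (rule tendsto_0_le[where K = "exp 1 / ln 2"])
    show "(\<lambda>n. of_nat (Suc n) * z ^ n) \<longlonglongrightarrow> 0"
      using tendsto_add[OF powser_times_n_limit_0[of z] LIMSEQ_power_zero[of z]] z
      by (simp add: algebra_simps)
    show "\<forall>\<^sub>F n in sequentially. norm (deriv (f n) z) \<le> norm (of_nat (Suc n) * z ^ n) * (exp 1 / ln 2)"
    proof (intro always_eventually allI)
      fix n
      have "exp (-1) * ln 2 \<le> exp (-1) * ln (real (Suc n) + 1)" by (intro mult_left_mono ln_mono) auto
      also have "\<dots> \<le> ?N (Suc n)" by (rule log_le_bloch_seminorm_monomial) simp
      finally have "cmod (of_nat (Suc n) * z ^ n) / ?N (Suc n)
          \<le> cmod (of_nat (Suc n) * z ^ n) / (exp (-1) * ln 2)"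
        using N[of "Suc n"] by (intro divide_left_mono) auto
      then show "norm (deriv (f n) z) \<le> norm (of_nat (Suc n) * z ^ n) * (exp 1 / ln 2)"
        using N[of "Suc n"] by (simp add: df[OF z] norm_divide exp_minus field_simps)
    qed
  qed
  then have lim: "(\<lambda>n. bloch_seminorm \<mu> (comp_op \<phi> (f n))) \<longlonglongrightarrow> 0"
    by (rule compact_comp_op_null[OF \<mu> \<phi> comp f_in f_norm])
  have upper: "bloch_seminorm \<mu> (comp_op \<phi> (f n)) \<ge> ?a (Suc n) / ?N (Suc n)" for n
  proof -
    have mem: "comp_op \<phi> (f n) \<in> bloch_space \<mu>"
      using comp f_in[of n] by (simp add: bloch_compact_operator_def image_subset_iff)
    have "?a (Suc n) \<le> bloch_seminorm \<mu> (comp_op \<phi> (f n)) * ?N (Suc n)"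
    proof (rule bloch_seminorm_le)
      fix z assume z: "z \<in> unit_disk"
      then have "\<phi> z \<in> unit_disk" using \<phi> by blast
      then have "deriv (comp_op \<phi> (f n)) z = deriv (\<lambda>z. \<phi> z ^ Suc n) z / of_real (?N (Suc n))"
        using deriv_comp_op[OF \<phi> bloch_space_holomorphic[OF f_in] z]
        by (simp add: df deriv_power_disk[OF \<phi>(1) z] del: power_Suc)
      then have "\<mu> z * cmod (deriv (\<lambda>z. \<phi> z ^ Suc n) z)
          = \<mu> z * cmod (deriv (comp_op \<phi> (f n)) z) * ?N (Suc n)"
        using N[of "Suc n"] by (simp add: norm_divide)
      also have "\<dots> \<le> bloch_seminorm \<mu> (comp_op \<phi> (f n)) * ?N (Suc n)"
        using bloch_space_deriv_le[OF mem z] N[of "Suc n"] by (intro mult_right_mono) auto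
      finally show "\<mu> z * cmod (deriv (\<lambda>z. \<phi> z ^ Suc n) z)
          \<le> bloch_seminorm \<mu> (comp_op \<phi> (f n)) * ?N (Suc n)" .
    qed
    then show ?thesis using N[of "Suc n"] by (simp add: pos_divide_le_eq)
  qed
  have lower: "0 \<le> ?a (Suc n) / ?N (Suc n)" for n
    using bloch_seminorm_nonneg[OF \<mu> fin, of "Suc n"] N[of "Suc n"] by simp
  have "(\<lambda>n. ?a (Suc n) / ?N (Suc n)) \<longlonglongrightarrow> 0"
  proof (rule tendsto_sandwich[OF _ _ tendsto_const lim])
    show "\<forall>\<^sub>F n in sequentially. 0 \<le> ?a (Suc n) / ?N (Suc n)"
      by (rule always_eventually, rule allI, rule lower)
    show "\<forall>\<^sub>F n in sequentially. ?a (Suc n) / ?N (Suc n) \<le> bloch_seminorm \<mu> (comp_op \<phi> (f n))"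
      by (rule always_eventually, rule allI, rule upper)
  qed
  then show ?thesis by (rule LIMSEQ_imp_Suc)
qed

theorem theorem5p4:
  fixes \<mu> :: "complex \<Rightarrow> real" and \<phi> :: "complex \<Rightarrow> complex"
  assumes "disk_weight \<mu>"
    and "\<phi> holomorphic_on unit_disk"
    and "\<phi> ` unit_disk \<subseteq> unit_disk"
    and "\<forall>f \<in> bloch_space v_log. comp_op \<phi> f \<in> bloch_space \<mu>"
  shows "(bloch_compact_operator v_log \<mu> (comp_op \<phi>) \<longleftrightarrow>
            (\<lambda>j::nat. bloch_seminorm \<mu> (\<lambda>z. \<phi> z ^ j) / ln (real j + 1)) \<longlonglongrightarrow> 0)
       \<and> ((\<lambda>j::nat. bloch_seminorm \<mu> (\<lambda>z. \<phi> z ^ j) / ln (real j + 1)) \<longlonglongrightarrow> 0 \<longleftrightarrow>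
            (\<lambda>j::nat. bloch_seminorm \<mu> (\<lambda>z. \<phi> z ^ j) / bloch_seminorm v_log (\<lambda>z. z ^ j)) \<longlonglongrightarrow> 0)"
proof -
  note \<mu> = assms(1) and \<phi> = assms(2,3)
  let ?a = "\<lambda>j::nat. bloch_seminorm \<mu> (\<lambda>z. \<phi> z ^ j)"
  let ?N = "\<lambda>j::nat. bloch_seminorm v_log (\<lambda>z. z ^ j)"
  let ?L = "\<lambda>j::nat. ln (real j + 1)"
  note N = bloch_seminorm_monomial_pos
  have T: "comp_op \<phi> f \<in> bloch_space \<mu>" if "f \<in> bloch_space v_log" for f
    using that assms(4) by blast
  note fin = bloch_finite_power_symbol[OF \<phi>(2) T]
  have L: "0 < ?L j" and a0: "0 \<le> ?a j" and N_le: "?N j \<le> 3 * ?L j" and N_ge: "exp (-1) * ?L j \<le> ?N j"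
    if "1 \<le> j" for j
    using that fin bloch_seminorm_nonneg[OF \<mu>] monomial_in_log_bloch log_le_bloch_seminorm_monomial
    by auto
  have iii_ii: "(\<lambda>j. ?a j / ?L j) \<longlonglongrightarrow> 0" if "(\<lambda>j. ?a j / ?N j) \<longlonglongrightarrow> 0"
  proof (rule tendsto_0_le[OF that])
    show "\<forall>\<^sub>F j in sequentially. norm (?a j / ?L j) \<le> norm (?a j / ?N j) * 3"
      using eventually_ge_at_top[of 1]
    proof eventually_elim
      case (elim j)
      have "?a j / ?L j \<le> ?a j / (?N j / 3)"
        using L[OF elim] N[OF elim] N_le[OF elim] a0[OF elim] by (intro divide_left_mono) auto
      then show ?case using L[OF elim] N[OF elim] a0[OF elim] by (simp add: mult.commute)
    qed
  qed
  have ii_iii: "(\<lambda>j. ?a j / ?N j) \<longlonglongrightarrow> 0" if "(\<lambda>j. ?a j / ?L j) \<longlonglongrightarrow> 0"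
  proof (rule tendsto_0_le[OF that])
    show "\<forall>\<^sub>F j in sequentially. norm (?a j / ?N j) \<le> norm (?a j / ?L j) * exp 1"
      using eventually_ge_at_top[of 1]
    proof eventually_elim
      case (elim j)
      have "?a j / ?N j \<le> ?a j / (exp (-1) * ?L j)"
        using L[OF elim] N[OF elim] N_ge[OF elim] a0[OF elim] by (intro divide_left_mono) auto
      then show ?case using L[OF elim] N[OF elim] a0[OF elim]
        by (simp add: exp_minus field_simps)
    qed
  qed
  have ii_i: "bloch_compact_operator v_log \<mu> (comp_op \<phi>)" if "(\<lambda>j. ?a j / ?L j) \<longlonglongrightarrow> 0"
    by (rule comp_op_compact_if_vanishing[OF disk_weight_v_log \<mu> \<phi> T
          power_seminorm_log_vanishing[OF \<mu> \<phi> fin that]])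
  show ?thesis
    using iii_ii ii_iii ii_i compact_comp_op_monomials[OF \<mu> \<phi> fin] by blast
qed

end
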